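(* Let $T(\mathbf{x})$, $\mathbf{x}\in\mathbb{S}^2$, be an isotropic spherical random field with covariance function $C(\mathbf{x}_1,\mathbf{x}_2)=B(\gamma(\mathbf{x}_1,\mathbf{x}_2))$, where $B:[0,\pi]\to\mathbb{R}$ is strictly positive. Let $V:\mathbb{S}^2\to\mathbb{R}$ be a continuous deterministic function and $T_V(\mathbf{x})=V(\mathbf{x})T(\mathbf{x})$. Then: (1) if $V$ is constant on $\mathbb{S}^2$, then $T_V$ is isotropic; (2) if $V(\mathbf{x}_0)=0$, then $T_V$ is isotropic at the point $\mathbf{x}_0$; (3) if there exists a point $\mathbf{x}_0$ such that $V(\mathbf{x})\ne 0$ for all $\mathbf{x}\in\mathbb{S}^2\setminus\{\mathbf{x}_0\}$, $V$ is constant on every circle $O(\mathbf{x}_0,r)$, $r\in(0,\pi)$, and there are two distinct radii $r_0'\ne r_0''$ for which these constants are different, then $T_V$ is isotropic precisely at the antipodal points $\mathbf{x}_0$ and $\mathbf{x}_0'=-\mathbf{x}_0$; (4) if $V(\mathbf{x})\neq 0$ for all $\mathbf{x}\in\mathbb{S}^2$, and no pair of antipodal points satisfies the conditions in (3), then $T_V$ is strictly anisotropic.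
   Context: $\mathbb{S}^2$ is the unit sphere in $\mathbb{R}^3$, $\gamma$ is the great-circle (angular) distance, and $O(\mathbf{x}_0,r)=\{\mathbf{x}\in\mathbb{S}^2:\gamma(\mathbf{x}_0,\mathbf{x})=r\}$. The base field $T$ is a real-valued second-order random field with zero mean and continuous, not identically constant covariance function. For a zero-mean second-order field with covariance function $C$ (such as $T_V$, whose covariance is $V(\mathbf{x}_1)V(\mathbf{x}_2)B(\gamma(\mathbf{x}_1,\mathbf{x}_2))$): the field is isotropic if $C(\mathbf{x}_1,\mathbf{x}_2)$ is a function of $\gamma(\mathbf{x}_1,\mathbf{x}_2)$ only; it is isotropic at a point $\mathbf{x}_0$ if $C(\mathbf{x}_0,\mathbf{x})=B_{\mathbf{x}_0}(\gamma(\mathbf{x}_0,\mathbf{x}))$ for some $B_{\mathbf{x}_0}:[0,\pi]\to\mathbb{R}$ and all $\mathbf{x}$; it is strictly anisotropic if there is no point of $\mathbb{S}^2$ at which it is isotropic.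
   Formalization: Part (4) additionally assumes that V is not constant on the sphere: as worded, a nonzero constant V meets the hypotheses of (4), since the conditions in (3) require two different constants, yet T_V is then isotropic by (1). *)

theory Defs
  imports "HOL-Probability.Probability"
begin

abbreviation S2 :: "(real ^ 3) set" where
  "S2 \<equiv> sphere 0 1"

definition angular_dist :: "real ^ 3 \<Rightarrow> real ^ 3 \<Rightarrow> real" where
  "angular_dist x y = arccos (x \<bullet> y)"

definition sph_circle :: "real ^ 3 \<Rightarrow> real \<Rightarrow> (real ^ 3) set" where
  "sph_circle x0 r = {x \<in> S2. angular_dist x0 x = r}"

text \<open>A random field on the sphere is a family \<open>T x\<close> of real random variables on \<open>M\<close>;
  only the indices \<open>x \<in> S2\<close> matter.\<close>

definition second_order_field :: "'w measure \<Rightarrow> (real ^ 3 \<Rightarrow> 'w \<Rightarrow> real) \<Rightarrow> bool" where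
  "second_order_field M T \<longleftrightarrow> prob_space M \<and>
     (\<forall>x\<in>S2. T x \<in> borel_measurable M \<and> integrable M (\<lambda>\<omega>. (T x \<omega>)\<^sup>2))"

definition zero_mean :: "'w measure \<Rightarrow> (real ^ 3 \<Rightarrow> 'w \<Rightarrow> real) \<Rightarrow> bool" where
  "zero_mean M T \<longleftrightarrow> (\<forall>x\<in>S2. integral\<^sup>L M (T x) = 0)"

definition covariance :: "'w measure \<Rightarrow> (real ^ 3 \<Rightarrow> 'w \<Rightarrow> real) \<Rightarrow> real ^ 3 \<Rightarrow> real ^ 3 \<Rightarrow> real" where
  "covariance M T x y =
     integral\<^sup>L M (\<lambda>\<omega>. (T x \<omega> - integral\<^sup>L M (T x)) * (T y \<omega> - integral\<^sup>L M (T y)))"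

text \<open>In the next two definitions only the values of \<open>b\<close> on \<open>{0..pi}\<close>, the range of
  \<^const>\<open>angular_dist\<close> on \<open>S2\<close>, are relevant.\<close>

definition isotropic :: "'w measure \<Rightarrow> (real ^ 3 \<Rightarrow> 'w \<Rightarrow> real) \<Rightarrow> bool" where
  "isotropic M T \<longleftrightarrow>
     (\<exists>b :: real \<Rightarrow> real. \<forall>x\<in>S2. \<forall>y\<in>S2. covariance M T x y = b (angular_dist x y))"

definition isotropic_at :: "'w measure \<Rightarrow> (real ^ 3 \<Rightarrow> 'w \<Rightarrow> real) \<Rightarrow> real ^ 3 \<Rightarrow> bool" where
  "isotropic_at M T x0 \<longleftrightarrow>
     (\<exists>b :: real \<Rightarrow> real. \<forall>x\<in>S2. covariance M T x0 x = b (angular_dist x0 x))"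

definition strictly_anisotropic :: "'w measure \<Rightarrow> (real ^ 3 \<Rightarrow> 'w \<Rightarrow> real) \<Rightarrow> bool" where
  "strictly_anisotropic M T \<longleftrightarrow> \<not> (\<exists>x0\<in>S2. isotropic_at M T x0)"

definition modulated_field ::
    "(real ^ 3 \<Rightarrow> real) \<Rightarrow> (real ^ 3 \<Rightarrow> 'w \<Rightarrow> real) \<Rightarrow> real ^ 3 \<Rightarrow> 'w \<Rightarrow> real" where
  "modulated_field V T = (\<lambda>x \<omega>. V x * T x \<omega>)"

text \<open>\<open>c r\<close> is the constant value of \<open>V\<close> on the circle of radius \<open>r\<close>; it is determined for
  \<open>0 < r < pi\<close>, where the circles are nonempty. Degenerate circles are not constrained,
  and \<open>V x0 = 0\<close> is allowed.\<close>

definition zonal_nonconstant :: "(real ^ 3 \<Rightarrow> real) \<Rightarrow> real ^ 3 \<Rightarrow> bool" where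
  "zonal_nonconstant V x0 \<longleftrightarrow>
     (\<forall>x\<in>S2 - {x0}. V x \<noteq> 0) \<and>
     (\<exists>c :: real \<Rightarrow> real.
        (\<forall>r\<in>{0<..<pi}. \<forall>x\<in>sph_circle x0 r. V x = c r) \<and>
        (\<exists>r1\<in>{0<..<pi}. \<exists>r2\<in>{0<..<pi}. r1 \<noteq> r2 \<and> c r1 \<noteq> c r2))"

end

theory Submission
  imports Defs
begin

text \<open>The field \<open>V T\<close> has covariance \<open>V x * V y * B (\<gamma> x y)\<close> with \<open>B > 0\<close>, so it is isotropic at
  \<open>x\<close> iff \<open>V x = 0\<close> or \<open>V\<close> depends on \<open>y\<close> only through \<open>x \<bullet> y\<close>. Suppose \<open>V y = g (p \<bullet> y) = h (q \<bullet> y)\<close>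
  for two axes \<open>p \<noteq> \<plusminus>q\<close> and put \<open>a = p \<bullet> q\<close>. Points of the sphere with prescribed products \<open>(s, t)\<close>
  with \<open>(p, q)\<close> exist iff the Gram determinant \<open>1 - a\<^sup>2 - s\<^sup>2 - t\<^sup>2 + 2 a s t\<close> is nonnegative. The pairs
  \<open>(a t, t)\<close> and \<open>(a t, a\<^sup>2 t)\<close> give \<open>h t = g (a t) = h (a\<^sup>2 t)\<close>; iterating brings the argument so close
  to \<open>0\<close> that the circle \<open>p \<bullet> y = 0\<close> reaches it, whence \<open>h\<close> is constant on \<open>[-1, 1]\<close>.\<close>

text \<open>The argument of \<open>g\<close> is the cosine of the angle at \<open>p\<close>, which
  is equivalent to the angle itself on the unit sphere. This form makes the comparison of two axes
  polynomial algebra.\<close>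

definition zonal_about :: "('a::euclidean_space \<Rightarrow> real) \<Rightarrow> 'a \<Rightarrow> bool" where
  "zonal_about f p \<longleftrightarrow> (\<exists>g. \<forall>y\<in>sphere 0 1. f y = g (p \<bullet> y))"

section \<open>Unit vectors and angular distance\<close>

lemma inner_unit_bounds:
  fixes x y :: "'a::real_inner"
  assumes "norm x = 1" "norm y = 1"
  shows "- 1 \<le> x \<bullet> y" "x \<bullet> y \<le> 1"
  using Cauchy_Schwarz_ineq2[of x y] assms by auto

lemma inner_unit_eq_1:
  fixes x y :: "'a::real_inner"
  assumes "norm x = 1" "norm y = 1" "x \<bullet> y = 1"
  shows "y = x"
proof -
  have "x \<bullet> x = 1" "y \<bullet> y = 1"
    using assms by (simp_all add: dot_square_norm)
  then have "(y - x) \<bullet> (y - x) = 0"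
    using assms(3) by (simp add: inner_diff_left inner_diff_right inner_commute)
  then show ?thesis by simp
qed

lemma inner_unit_eq_minus_1:
  fixes x y :: "'a::real_inner"
  assumes "norm x = 1" "norm y = 1" "x \<bullet> y = - 1"
  shows "y = - x"
proof -
  have "- y = x" using inner_unit_eq_1[of x "- y"] assms by simp
  then show ?thesis by auto
qed

lemma cos_angular_dist:
  assumes "x \<in> S2" "y \<in> S2"
  shows "cos (angular_dist x y) = x \<bullet> y"
  using inner_unit_bounds[of x y] assms by (simp add: angular_dist_def)

lemma angular_dist_bounds:
  assumes "x \<in> S2" "y \<in> S2"
  shows "angular_dist x y \<in> {0..pi}"
  using inner_unit_bounds[of x y] assms by (simp add: angular_dist_def arccos_lbound arccos_ubound)

text \<open>The circles of radius \<open>0\<close> and \<open>pi\<close> about \<open>x\<close> are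
  the single points \<open>x\<close> and \<open>- x\<close>. They are split off because
  \<open>zonal_nonconstant\<close> does not constrain them.\<close>

lemma angular_dist_cases:
  assumes "x \<in> S2" "y \<in> S2"
  obtains "y = x" | "y = - x" | "angular_dist x y \<in> {0<..<pi}"
proof -
  consider "x \<bullet> y = 1" | "x \<bullet> y = - 1" | "- 1 < x \<bullet> y" "x \<bullet> y < 1"
    using inner_unit_bounds[of x y] assms by force
  then show thesis
  proof cases
    case 1
    then show ?thesis using that(1) inner_unit_eq_1[of x y] assms by simp
  next
    case 2
    then show ?thesis using that(2) inner_unit_eq_minus_1[of x y] assms by simp
  next
    case 3
    then show ?thesis using that(3) by (simp add: angular_dist_def arccos_lt_bounded)
  qed
qed

section \<open>Isotropy of the modulated field at a point\<close>

lemma covariance_modulated_field: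
  "covariance M (modulated_field V T) x y = V x * V y * covariance M T x y"
proof -
  \<comment> \<open>\<open>I\<close> and \<open>J\<close> stand for the means of \<open>T x\<close>
    and \<open>T y\<close>; the means of the modulated field are \<open>V x * I\<close> and
    \<open>V y * J\<close>.\<close>
  have "(V x * T x \<omega> - V x * I) * (V y * T y \<omega> - V y * J)
      = (V x * V y) * ((T x \<omega> - I) * (T y \<omega> - J))" for \<omega> I J
    by (simp add: algebra_simps)
  then show ?thesis by (simp add: covariance_def modulated_field_def)
qed

text \<open>If \<open>V p \<noteq> 0\<close>, then positivity of \<open>B\<close> allows division of
  the covariance by \<open>V p * B (angular_dist p y)\<close>, which leaves \<open>V y\<close> as a
  function of the angle. If \<open>V p = 0\<close>, the covariance with the value at
  \<open>p\<close> vanishes identically.\<close>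

lemma isotropic_at_modulated_field_iff:
  assumes cov: "\<And>x y. x \<in> S2 \<Longrightarrow> y \<in> S2 \<Longrightarrow> covariance M T x y = B (angular_dist x y)"
    and pos: "\<And>r. r \<in> {0..pi} \<Longrightarrow> B r > 0"
    and p: "p \<in> S2"
  shows "isotropic_at M (modulated_field V T) p \<longleftrightarrow> V p = 0 \<or> zonal_about V p"
proof
  assume "isotropic_at M (modulated_field V T) p"
  then obtain b where b: "\<And>y. y \<in> S2 \<Longrightarrow> V p * V y * B (angular_dist p y) = b (angular_dist p y)"
    unfolding isotropic_at_def covariance_modulated_field using cov p by metis
  show "V p = 0 \<or> zonal_about V p"
  proof (cases "V p = 0")
    case nz: False
    have "V y = b (arccos (p \<bullet> y)) / (V p * B (arccos (p \<bullet> y)))" if "y \<in> S2" for y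
      using b[OF that] nz pos[OF angular_dist_bounds[OF p that]]
      by (simp add: angular_dist_def field_simps)
    then have "zonal_about V p"
      unfolding zonal_about_def by (intro exI[of _ "\<lambda>u. b (arccos u) / (V p * B (arccos u))"]) blast
    then show ?thesis ..
  qed simp
next
  assume "V p = 0 \<or> zonal_about V p"
  then show "isotropic_at M (modulated_field V T) p"
  proof
    assume "V p = 0"
    then show ?thesis
      unfolding isotropic_at_def covariance_modulated_field by (intro exI[of _ "\<lambda>_. 0"]) simp
  next
    assume "zonal_about V p"
    then obtain g where g: "\<And>y. y \<in> S2 \<Longrightarrow> V y = g (p \<bullet> y)"
      unfolding zonal_about_def by blast
    show ?thesis
      unfolding isotropic_at_def covariance_modulated_field
    proof (intro exI[of _ "\<lambda>r. V p * g (cos r) * B r"] ballI)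
      fix y assume "y \<in> S2"
      then show "V p * V y * covariance M T p y
          = V p * g (cos (angular_dist p y)) * B (angular_dist p y)"
        using g cov p cos_angular_dist by simp
    qed
  qed
qed

section \<open>Zonal functions and values on circles\<close>

lemma zonal_about_uminus:
  assumes "zonal_about f p"
  shows "zonal_about f (- p)"
proof -
  obtain g where "\<forall>y\<in>sphere 0 1. f y = g (p \<bullet> y)"
    using assms unfolding zonal_about_def by blast
  then show ?thesis
    unfolding zonal_about_def by (intro exI[of _ "\<lambda>u. g (- u)"]) simp
qed

lemma zonal_aboutI:
  assumes p: "p \<in> S2"
    and c: "\<And>r x. r \<in> {0<..<pi} \<Longrightarrow> x \<in> sph_circle p r \<Longrightarrow> V x = c r"
  shows "zonal_about V p"
  unfolding zonal_about_def
proof (intro exI ballI)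
  fix y assume y: "y \<in> S2"
  have "p \<bullet> p = 1" using p by (simp add: dot_square_norm)
  \<comment> \<open>A pole is a single point, so the profile can simply take the value of
    \<open>V\<close> there; \<open>c\<close> supplies all other circles.\<close>
  show "V y = (\<lambda>u. if u = 1 then V p else if u = - 1 then V (- p) else c (arccos u)) (p \<bullet> y)"
    using p y
  proof (cases rule: angular_dist_cases)
    case 3
    then have "p \<bullet> y \<noteq> 1" "p \<bullet> y \<noteq> - 1"
      by (auto simp: angular_dist_def)
    moreover have "V y = c (arccos (p \<bullet> y))"
      using c[OF 3, of y] y by (simp add: sph_circle_def angular_dist_def)
    ultimately show ?thesis by simp
  qed (use \<open>p \<bullet> p = 1\<close> in simp_all)
qed

text \<open>With \<open>w\<close> a unit vector orthogonal to \<open>p\<close>, the curve is a half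
  great circle from \<open>p\<close> to \<open>- p\<close> that meets each circle about
  \<open>p\<close> once. It shows that these circles are nonempty and carries continuity of
  \<open>V\<close> over to its radial profile.\<close>

lemma meridian:
  assumes "p \<in> S2"
  obtains w where "\<And>r. cos r *\<^sub>R p + sin r *\<^sub>R w \<in> S2"
    and "\<And>r. r \<in> {0..pi} \<Longrightarrow> angular_dist p (cos r *\<^sub>R p + sin r *\<^sub>R w) = r"
proof -
  have pp: "p \<bullet> p = 1" using assms by (simp add: dot_square_norm)
  obtain v :: "real ^ 3" where v: "v \<noteq> 0" "orthogonal p v"
    using orthogonal_to_vector_exists[of p] by auto
  define w where "w = v /\<^sub>R norm v"
  have ww: "w \<bullet> w = 1" and pw: "p \<bullet> w = 0"
    using v by (simp_all add: w_def orthogonal_def dot_square_norm power2_eq_square)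
  have "(cos r *\<^sub>R p + sin r *\<^sub>R w) \<bullet> (cos r *\<^sub>R p + sin r *\<^sub>R w) = (cos r)\<^sup>2 + (sin r)\<^sup>2" for r
    using pp ww pw
    by (simp add: inner_add_left inner_add_right inner_commute[of w p] power2_eq_square)
  then have "cos r *\<^sub>R p + sin r *\<^sub>R w \<in> S2" for r
    by (simp add: norm_eq_1)
  moreover have "angular_dist p (cos r *\<^sub>R p + sin r *\<^sub>R w) = r" if "r \<in> {0..pi}" for r
    using that pp pw by (simp add: angular_dist_def inner_add_right arccos_cos)
  ultimately show thesis using that by blast
qed

lemma zonal_nonconstant_imp_zonal_about:
  assumes "p \<in> S2" "zonal_nonconstant V p"
  shows "zonal_about V p"
  using assms zonal_aboutI[of p V] unfolding zonal_nonconstant_def by blast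

text \<open>Each circle with \<open>0 < r < pi\<close> contains a point of the meridian, so
  \<open>c r\<close> is an actual value of \<open>V\<close>, and two different values of
  \<open>c\<close> are two different values of \<open>V\<close>.\<close>

lemma zonal_nonconstant_imp_not_constant_on:
  assumes p: "p \<in> S2" and "zonal_nonconstant V p"
  shows "\<not> V constant_on S2"
proof
  assume "V constant_on S2"
  then obtain k where k: "\<And>x. x \<in> S2 \<Longrightarrow> V x = k" unfolding constant_on_def by blast
  obtain c r1 r2 where c: "\<And>r x. r \<in> {0<..<pi} \<Longrightarrow> x \<in> sph_circle p r \<Longrightarrow> V x = c r"
    and r: "r1 \<in> {0<..<pi}" "r2 \<in> {0<..<pi}" "c r1 \<noteq> c r2"
    using assms unfolding zonal_nonconstant_def by blast
  obtain w where w: "\<And>r. cos r *\<^sub>R p + sin r *\<^sub>R w \<in> S2"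
    "\<And>r. r \<in> {0..pi} \<Longrightarrow> angular_dist p (cos r *\<^sub>R p + sin r *\<^sub>R w) = r"
    using meridian[OF p] by blast
  have "c r = k" if "r \<in> {0<..<pi}" for r
    using c[OF that, of "cos r *\<^sub>R p + sin r *\<^sub>R w"] w[of r] k that
    by (simp add: sph_circle_def)
  then show False using r by metis
qed

text \<open>A profile constant on the open interval of radii keeps that constant at both poles by
  continuity. A nonconstant \<open>V\<close> must therefore already vary between proper
  circles.\<close>

lemma zonal_about_imp_zonal_nonconstant:
  assumes p: "p \<in> S2" and zonal: "zonal_about V p" and cont: "continuous_on S2 V"
    and nz: "\<And>x. x \<in> S2 \<Longrightarrow> V x \<noteq> 0" and nconst: "\<not> V constant_on S2"
  shows "zonal_nonconstant V p"
proof -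
  obtain g where g: "\<And>y. y \<in> S2 \<Longrightarrow> V y = g (p \<bullet> y)"
    using zonal unfolding zonal_about_def by blast
  define c where "c r = g (cos r)" for r
  have c: "V y = c (angular_dist p y)" if "y \<in> S2" for y
    using g that p cos_angular_dist by (simp add: c_def)
  have "\<exists>r1\<in>{0<..<pi}. \<exists>r2\<in>{0<..<pi}. r1 \<noteq> r2 \<and> c r1 \<noteq> c r2"
  proof (rule ccontr)
    assume const: "\<not> ?thesis"
    \<comment> \<open>The radius \<open>pi / 2\<close> is only a reference value inside the open
      interval.\<close>
    have inner_const: "c r = c (pi / 2)" if "r \<in> {0<..<pi}" for r
    proof -
      have "pi / 2 \<in> {0<..<pi}" by simp
      then show ?thesis using that const by metis
    qed
    obtain w where w: "\<And>r. cos r *\<^sub>R p + sin r *\<^sub>R w \<in> S2"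
      "\<And>r. r \<in> {0..pi} \<Longrightarrow> angular_dist p (cos r *\<^sub>R p + sin r *\<^sub>R w) = r"
      using meridian[OF p] by blast
    have "continuous_on {0..pi} (\<lambda>r. V (cos r *\<^sub>R p + sin r *\<^sub>R w))"
      by (rule continuous_on_compose2[OF cont]) (use w(1) in \<open>auto intro!: continuous_intros\<close>)
    then have "continuous_on {0..pi} c"
      by (rule continuous_on_eq) (use c w in auto)
    then have "c r = c (pi / 2)" if "r \<in> {0..pi}" for r
      by (rule continuous_constant_on_closure[of "{0<..<pi}", simplified, OF _ inner_const])
        (use that in simp_all)
    then have "V constant_on S2"
      using c angular_dist_bounds[OF p] unfolding constant_on_def by metis
    then show False using nconst by simp
  qed
  moreover have "V x = c r" if "x \<in> sph_circle p r" for x r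
    using that c by (auto simp: sph_circle_def)
  ultimately show ?thesis
    using nz unfolding zonal_nonconstant_def by (intro conjI exI[of _ c]) blast+
qed

section \<open>Functions zonal about two axes\<close>

text \<open>In the basis \<open>p\<close>, \<open>q\<close>, \<open>cross3 p q\<close>, the two
  prescribed products determine the first two coefficients by a linear system of determinant
  \<open>1 - a\<^sup>2\<close>. The unit norm then determines the third up to sign, and it is real
  exactly when the Gram determinant is nonnegative.\<close>

lemma sphere_point_with_inner_products:
  fixes p q :: "real ^ 3" and s t :: real
  defines "a \<equiv> p \<bullet> q"
  assumes unit: "p \<in> S2" "q \<in> S2"
    and a: "a\<^sup>2 < 1"
    and gram: "0 \<le> 1 - a\<^sup>2 - s\<^sup>2 - t\<^sup>2 + 2 * a * s * t"
  obtains y where "y \<in> S2" "p \<bullet> y = s" "q \<bullet> y = t"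
proof -
  define d where "d = 1 - a\<^sup>2"
  define n where "n = cross3 p q"
  define k where "k = sqrt (1 - a\<^sup>2 - s\<^sup>2 - t\<^sup>2 + 2 * a * s * t)"
  define y where "y = ((s - a * t) / d) *\<^sub>R p + ((t - a * s) / d) *\<^sub>R q + (k / d) *\<^sub>R n"
  have d: "d > 0" using a by (simp add: d_def)
  have pp: "p \<bullet> p = 1" and qq: "q \<bullet> q = 1"
    using unit by (simp_all add: dot_square_norm)
  have pq: "p \<bullet> q = a" "q \<bullet> p = a"
    by (simp_all add: a_def inner_commute)
  have nn: "n \<bullet> n = d"
    unfolding n_def d_def using norm_cross_dot[of p q] unit
    by (simp add: dot_square_norm a_def power_mult_distrib)
  have pn: "p \<bullet> n = 0" "n \<bullet> p = 0" and qn: "q \<bullet> n = 0" "n \<bullet> q = 0"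
    by (simp_all add: n_def dot_cross_self)
  have py: "p \<bullet> y = s"
  proof -
    have "p \<bullet> y = ((s - a * t) + (t - a * s) * a) / d"
      by (simp add: y_def inner_add_right pp pq pn add_divide_distrib)
    also have "\<dots> = s * d / d"
      by (simp add: d_def algebra_simps power2_eq_square)
    finally show ?thesis using d by simp
  qed
  have qy: "q \<bullet> y = t"
  proof -
    have "q \<bullet> y = ((s - a * t) * a + (t - a * s)) / d"
      by (simp add: y_def inner_add_right qq pq qn add_divide_distrib)
    also have "\<dots> = t * d / d"
      by (simp add: d_def algebra_simps power2_eq_square)
    finally show ?thesis using d by simp
  qed
  have ny: "n \<bullet> y = k"
    using d by (simp add: y_def inner_add_right pn qn nn)
  have k2: "k * k = 1 - a\<^sup>2 - s\<^sup>2 - t\<^sup>2 + 2 * a * s * t"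
    using gram by (simp add: k_def)
  \<comment> \<open>Only the left factor is expanded, so that the products of \<open>y\<close> with
    \<open>p\<close>, \<open>q\<close> and \<open>n\<close> found above can be reused.\<close>
  have "y \<bullet> y = ((s - a * t) / d) * (p \<bullet> y) + ((t - a * s) / d) * (q \<bullet> y) + (k / d) * (n \<bullet> y)"
    by (subst (1) y_def) (simp only: inner_add_left inner_scaleR_left)
  also have "\<dots> = ((s - a * t) * s + (t - a * s) * t + k * k) / d"
    by (simp add: py qy ny add_divide_distrib)
  also have "\<dots> = d / d"
    unfolding k2 by (simp add: d_def algebra_simps power2_eq_square)
  finally have "y \<bullet> y = 1" using d by simp
  then show thesis
    using that py qy by (simp add: norm_eq_1)
qed

lemma zonal_about_two_axes_imp_constant_on:
  fixes p q :: "real ^ 3"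
  assumes unit: "p \<in> S2" "q \<in> S2" and ne: "q \<noteq> p" "q \<noteq> - p"
    and "zonal_about f p" "zonal_about f q"
  shows "f constant_on S2"
proof -
  obtain g h where g: "\<And>y. y \<in> S2 \<Longrightarrow> f y = g (p \<bullet> y)" and h: "\<And>y. y \<in> S2 \<Longrightarrow> f y = h (q \<bullet> y)"
    using assms(5,6) unfolding zonal_about_def by blast
  define a where "a = p \<bullet> q"
  have "a \<noteq> 1" "a \<noteq> - 1"
    using inner_unit_eq_1[of p q] inner_unit_eq_minus_1[of p q] unit ne by (auto simp: a_def)
  then have a2: "a\<^sup>2 < 1"
    using inner_unit_bounds[of p q] unit by (simp add: a_def abs_square_less_1)
  have link: "g s = h t" if "0 \<le> 1 - a\<^sup>2 - s\<^sup>2 - t\<^sup>2 + 2 * a * s * t" for s t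
  proof -
    obtain y where "y \<in> S2" "p \<bullet> y = s" "q \<bullet> y = t"
      using sphere_point_with_inner_products[OF unit] a2 \<open>0 \<le> _\<close> unfolding a_def by metis
    then show ?thesis using g h by metis
  qed
  \<comment> \<open>For fixed \<open>t\<close>, the choice \<open>s = a * t\<close> maximizes the
    Gram determinant in \<open>s\<close>; for fixed \<open>s\<close>, the choice
    \<open>a * s\<close> does so in the other variable. Applying both in turn multiplies
    \<open>t\<close> by \<open>a\<^sup>2\<close>.\<close>
  have contract: "h t = h (a\<^sup>2 * t)" if "t\<^sup>2 \<le> 1" for t
  proof -
    have "1 - a\<^sup>2 - (a * t)\<^sup>2 - t\<^sup>2 + 2 * a * (a * t) * t = (1 - a\<^sup>2) * (1 - t\<^sup>2)"
      by (simp add: algebra_simps power2_eq_square)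
    then have "g (a * t) = h t"
      using that a2 by (intro link) simp
    moreover have "1 - a\<^sup>2 - (a * t)\<^sup>2 - (a\<^sup>2 * t)\<^sup>2 + 2 * a * (a * t) * (a\<^sup>2 * t)
        = (1 - a\<^sup>2) * (1 - a\<^sup>2 * t\<^sup>2)"
      by (simp add: algebra_simps power2_eq_square)
    then have "g (a * t) = h (a\<^sup>2 * t)"
      using that a2 by (intro link) (simp add: mult_le_one)
    ultimately show ?thesis by simp
  qed
  \<comment> \<open>For \<open>s = 0\<close> the Gram determinant is
    \<open>1 - a\<^sup>2 - u\<^sup>2\<close>, so \<open>h u\<close> and \<open>h 0\<close> both
    equal \<open>g 0\<close>. This covers a whole neighbourhood of \<open>0\<close>, and finitely
    many contractions therefore suffice.\<close>
  have near_0: "h u = h 0" if "u\<^sup>2 \<le> 1 - a\<^sup>2" for u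
    using link[of 0 u] link[of 0 0] that a2 by simp
  have "h t = h 0" if "t\<^sup>2 \<le> 1" for t
  proof -
    \<comment> \<open>The bound is carried through the induction because \<open>contract\<close>
      requires it at each iterate.\<close>
    have iter: "((a\<^sup>2) ^ n * t)\<^sup>2 \<le> 1 \<and> h t = h ((a\<^sup>2) ^ n * t)" for n
    proof (induction n)
      case (Suc n)
      let ?u = "(a\<^sup>2) ^ n * t"
      have "(a\<^sup>2 * ?u)\<^sup>2 = (a\<^sup>2)\<^sup>2 * ?u\<^sup>2" by (simp add: power_mult_distrib)
      also have "\<dots> \<le> 1"
        using Suc.IH a2 power_le_one[of "a\<^sup>2" 2] by (intro mult_le_one) simp_all
      finally show ?case
        using Suc.IH contract[of ?u] by (simp add: mult.assoc)
    qed (use that in simp)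
    have "(\<lambda>n. ((a\<^sup>2) ^ n * t)\<^sup>2) \<longlonglongrightarrow> (0 * t)\<^sup>2"
      using a2 by (intro tendsto_intros LIMSEQ_power_zero) simp
    then have "eventually (\<lambda>n. ((a\<^sup>2) ^ n * t)\<^sup>2 < 1 - a\<^sup>2) sequentially"
      by (rule order_tendstoD(2)) (use a2 in simp)
    then obtain n where "((a\<^sup>2) ^ n * t)\<^sup>2 < 1 - a\<^sup>2"
      unfolding eventually_sequentially by blast
    then show ?thesis using near_0 iter[of n] by simp
  qed
  moreover have "(q \<bullet> y)\<^sup>2 \<le> 1" if "y \<in> S2" for y
    using inner_unit_bounds[of q y] unit that by (simp add: abs_square_le_1 abs_le_iff)
  ultimately show ?thesis
    using h unfolding constant_on_def by metis
qed

theorem theorem6: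
  fixes M :: "'w measure"
    and T :: "real ^ 3 \<Rightarrow> 'w \<Rightarrow> real"
    and B :: "real \<Rightarrow> real"
    and V :: "real ^ 3 \<Rightarrow> real"
  assumes "second_order_field M T"
    and "zero_mean M T"
    and "continuous_on (S2 \<times> S2) (\<lambda>(x, y). covariance M T x y)"
    and "\<not> (\<lambda>(x, y). covariance M T x y) constant_on (S2 \<times> S2)"
    and "\<And>x y. x \<in> S2 \<Longrightarrow> y \<in> S2 \<Longrightarrow> covariance M T x y = B (angular_dist x y)"
    and "\<And>r. r \<in> {0..pi} \<Longrightarrow> B r > 0"
    and "continuous_on S2 V"
  shows "(V constant_on S2 \<longrightarrow> isotropic M (modulated_field V T)) \<and>
    (\<forall>x0\<in>S2. V x0 = 0 \<longrightarrow> isotropic_at M (modulated_field V T) x0) \<and>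
    (\<forall>x0\<in>S2. zonal_nonconstant V x0 \<longrightarrow>
       {x \<in> S2. isotropic_at M (modulated_field V T) x} = {x0, - x0}) \<and>
    ((\<forall>x\<in>S2. V x \<noteq> 0) \<and> \<not> V constant_on S2 \<and> \<not> (\<exists>x0\<in>S2. zonal_nonconstant V x0) \<longrightarrow>
       strictly_anisotropic M (modulated_field V T))"
proof -
  note cov = assms(5) and pos = assms(6) and cont = assms(7)
  have iff: "isotropic_at M (modulated_field V T) p \<longleftrightarrow> V p = 0 \<or> zonal_about V p" if "p \<in> S2" for p
    by (rule isotropic_at_modulated_field_iff) (use cov pos that in auto)
  have const: "isotropic M (modulated_field V T)" if V: "V constant_on S2"
  proof -
    obtain k where "\<And>x. x \<in> S2 \<Longrightarrow> V x = k"
      using V unfolding constant_on_def by blast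
    then show ?thesis
      unfolding isotropic_def covariance_modulated_field
      using cov by (intro exI[of _ "\<lambda>r. k * k * B r"]) simp
  qed
  have zonal: "{x \<in> S2. isotropic_at M (modulated_field V T) x} = {p, - p}"
    if p: "p \<in> S2" and V: "zonal_nonconstant V p" for p
  proof -
    have zp: "zonal_about V p"
      using zonal_nonconstant_imp_zonal_about[OF p V] .
    have "x = p \<or> x = - p" if x: "x \<in> S2" and "isotropic_at M (modulated_field V T) x" for x
    proof (rule ccontr)
      assume ne: "\<not> (x = p \<or> x = - p)"
      \<comment> \<open>\<open>V\<close> can vanish only at \<open>p\<close>, and \<open>p\<close>
        is excluded by \<open>ne\<close>. A further isotropic point would thus be a second
        axis.\<close>
      then have "V x \<noteq> 0" using V x unfolding zonal_nonconstant_def by blast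
      then have "zonal_about V x" using iff[OF x] that(2) by blast
      then have "V constant_on S2"
        using zonal_about_two_axes_imp_constant_on[OF p x _ _ zp] ne by blast
      then show False using zonal_nonconstant_imp_not_constant_on[OF p V] by blast
    qed
    moreover have "isotropic_at M (modulated_field V T) p"
      using iff[OF p] zp by blast
    moreover have mp: "- p \<in> S2" using p by simp
    moreover have "isotropic_at M (modulated_field V T) (- p)"
      using iff[OF mp] zonal_about_uminus[OF zp] by blast
    ultimately show ?thesis using p by blast
  qed
  \<comment> \<open>The condition \<open>nc\<close> separates this case from constant
    \<open>V\<close>, for which no point satisfies \<open>zonal_nonconstant\<close> although the
    modulated field is isotropic.\<close>
  have "strictly_anisotropic M (modulated_field V T)"
    if nz: "\<forall>x\<in>S2. V x \<noteq> 0" and nc: "\<not> V constant_on S2"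
      and nzon: "\<not> (\<exists>x0\<in>S2. zonal_nonconstant V x0)"
    unfolding strictly_anisotropic_def
    using iff zonal_about_imp_zonal_nonconstant[OF _ _ cont _ nc] nz nzon by blast
  then show ?thesis
    using const zonal iff by blast
qed

end
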